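(* For all integers $k \geq 1$ and $d \geq 4$, \[\xi_k(K(d,2),\mathbb{R}) = \Big\lceil \frac{k}{2}\Big\rceil \cdot (d-4) + 2k.\]
   Context: For integers $d \geq 2s$, the Kneser graph $K(d,s)$ has as vertices all $s$-subsets of $[d]=\{1,\ldots,d\}$, two sets being adjacent if they are disjoint. A $t$-dimensional orthogonal $k$-subspace representation of a graph $G=(V,E)$ is an assignment of a linear subspace $U_v \subseteq \mathbb{R}^t$ with $\dim(U_v)=k$ to every vertex $v$, such that $U_v$ and $U_{v'}$ are orthogonal subspaces (with respect to the standard inner product) whenever $v,v'$ are adjacent. $\xi_k(G,\mathbb{R})$ denotes the smallest integer $t$ for which such a representation exists. *)

theory Defs
  imports
    Complex_Main
    "HOL-Library.Function_Algebras"
    "Graph_Theory.Pair_Digraph"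
begin

text \<open>
  The dimension \<open>t\<close> of the ambient space is minimised over, so it cannot be a type.
  We realise \<open>\<real>\<^sup>t\<close> as the real sequences vanishing from index \<open>t\<close> on.  With the pointwise
  vector space structure on functions, linear subspaces and dimensions are the library's
  \<open>subspace\<close> and \<open>dim\<close>.
\<close>

instantiation "fun" :: (type, real_vector) real_vector
begin

definition scaleR_fun_def: "c *\<^sub>R f = (\<lambda>x. c *\<^sub>R f x)"

instance
  by standard (simp_all add: scaleR_fun_def fun_eq_iff algebra_simps)

end

lemma scaleR_fun_apply [simp]: "(c *\<^sub>R f) x = c *\<^sub>R f x"
  by (simp add: scaleR_fun_def)

definition real_space :: "nat \<Rightarrow> (nat \<Rightarrow> real) set" where
  "real_space t = {x. \<forall>i\<ge>t. x i = 0}"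

definition std_inner :: "nat \<Rightarrow> (nat \<Rightarrow> real) \<Rightarrow> (nat \<Rightarrow> real) \<Rightarrow> real" where
  "std_inner t x y = (\<Sum>i<t. x i * y i)"

definition orthogonal_subspaces :: "nat \<Rightarrow> (nat \<Rightarrow> real) set \<Rightarrow> (nat \<Rightarrow> real) set \<Rightarrow> bool" where
  "orthogonal_subspaces t U W \<longleftrightarrow> (\<forall>x\<in>U. \<forall>y\<in>W. std_inner t x y = 0)"

lemma subspace_real_space: "subspace (real_space t)"
  by (auto simp: subspace_def real_space_def)

lemma dim_real_space: "dim (real_space t) = t"
proof -
  define e :: "nat \<Rightarrow> nat \<Rightarrow> real" where "e = (\<lambda>i j. if j = i then 1 else 0)"
  have sum_apply: "(\<Sum>v\<in>A. f v) j = (\<Sum>v\<in>A. f v j)"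
    for f :: "nat \<Rightarrow> nat \<Rightarrow> real" and A :: "nat set" and j
    by (induction A rule: infinite_finite_induct) auto
  have inj: "inj e"
  proof (rule injI)
    fix i j assume "e i = e j"
    then have "e i i = e j i" by simp
    then show "i = j" by (simp add: e_def split: if_splits)
  qed
  have sub: "e ` {..<t} \<subseteq> real_space t"
    by (auto simp: e_def real_space_def)
  have "real_space t \<subseteq> span (e ` {..<t})"
  proof
    fix x assume x: "x \<in> real_space t"
    have "x = (\<Sum>i<t. x i *\<^sub>R e i)"
    proof
      fix j
      have "(\<Sum>i<t. x i *\<^sub>R e i) j = (\<Sum>i<t. if j = i then x i else 0)"
        unfolding sum_apply by (rule sum.cong) (auto simp: e_def)
      also have "\<dots> = x j" using x by (auto simp: real_space_def)
      finally show "x j = (\<Sum>i<t. x i *\<^sub>R e i) j" by simp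
    qed
    moreover have "(\<Sum>i<t. x i *\<^sub>R e i) \<in> span (e ` {..<t})"
      by (intro span_sum span_scale span_base) auto
    ultimately show "x \<in> span (e ` {..<t})" by simp
  qed
  moreover have "independent (e ` {..<t})"
  proof (rule independent_if_scalars_zero)
    fix f v assume z: "(\<Sum>x\<in>e ` {..<t}. f x *\<^sub>R x) = 0" and "v \<in> e ` {..<t}"
    then obtain j where j: "j < t" "v = e j" by auto
    have "0 = (\<Sum>i<t. f (e i) *\<^sub>R e i) j"
      using z inj by (subst (asm) sum.reindex) (auto intro: inj_on_subset)
    also have "\<dots> = (\<Sum>i<t. if j = i then f (e i) else 0)"
      unfolding sum_apply by (rule sum.cong) (auto simp: e_def)
    finally show "f v = 0" using j by simp
  qed simp
  moreover have "card (e ` {..<t}) = t"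
    using inj by (subst card_image) (auto intro: inj_on_subset)
  ultimately show ?thesis using dim_unique[OF sub] by blast
qed

text \<open>
  Undirected graphs are symmetric digraphs without parallel arcs: an edge \<open>{u, v}\<close> is the
  pair of arcs \<open>(u, v)\<close>, \<open>(v, u)\<close>.
\<close>

definition kneser_graph :: "nat \<Rightarrow> nat \<Rightarrow> nat set pair_pre_digraph" where
  "kneser_graph d s =
     (let V = {A. A \<subseteq> {1..d} \<and> card A = s}
      in \<lparr>pverts = V, parcs = {(A, B). A \<in> V \<and> B \<in> V \<and> A \<inter> B = {}}\<rparr>)"

lemma pair_graph_kneser_graph:
  assumes "s \<ge> 1"
  shows "pair_graph (kneser_graph d s)"
proof
  let ?V = "{A. A \<subseteq> {1..d} \<and> card A = s}"
  have "finite ?V" by (rule finite_subset[of _ "Pow {1..d}"]) auto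
  then show "finite (pverts (kneser_graph d s))" by (simp add: kneser_graph_def)
  have "parcs (kneser_graph d s) \<subseteq> ?V \<times> ?V" by (auto simp: kneser_graph_def)
  then show "finite (parcs (kneser_graph d s))"
    by (rule finite_subset) (intro finite_cartesian_product \<open>finite ?V\<close>)
  have "sym (parcs (kneser_graph d s))"
    by (auto simp: kneser_graph_def intro!: symI)
  then show "symmetric (with_proj (kneser_graph d s))"
    by (simp add: symmetric_def arcs_ends_def arc_to_ends_def)
next
  fix e assume e: "e \<in> parcs (kneser_graph d s)"
  then show "fst e \<in> pverts (kneser_graph d s)" "snd e \<in> pverts (kneser_graph d s)"
    by (auto simp: kneser_graph_def)
  from e have "fst e \<inter> snd e = {}" "card (fst e) = s"
    by (auto simp: kneser_graph_def)
  with assms show "fst e \<noteq> snd e" by fastforce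
qed

definition orthogonal_subspace_representation ::
    "nat \<Rightarrow> nat \<Rightarrow> 'v pair_pre_digraph \<Rightarrow> ('v \<Rightarrow> (nat \<Rightarrow> real) set) \<Rightarrow> bool" where
  "orthogonal_subspace_representation t k G U \<longleftrightarrow>
     (\<forall>v\<in>pverts G. subspace (U v) \<and> U v \<subseteq> real_space t \<and> dim (U v) = k) \<and>
     (\<forall>(v, v')\<in>parcs G. orthogonal_subspaces t (U v) (U v'))"

definition xi :: "nat \<Rightarrow> 'v pair_pre_digraph \<Rightarrow> nat" where
  "xi k G = (LEAST t. \<exists>U. orthogonal_subspace_representation t k G U)"

end

theory Submission
  imports Defs
begin

text \<open>
  Upper bound: give the pair \<open>e\<close> the coordinate subspace of a set of \<open>k\<close> colours, where each point
  of \<open>[d]\<close> supplies \<open>\<lfloor>k/2\<rfloor>\<close> private colours to its pairs and, for odd \<open>k\<close>, one more colour comes from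
  the usual proper colouring of \<open>K(d,2)\<close> with \<open>d - 2\<close> colours.

  Lower bound, by induction on \<open>d\<close>, with \<open>h = \<lceil>k/2\<rceil>\<close>: call a triangle \<open>{i,j,a}\<close> tight if the sum of
  its three subspaces has dimension less than \<open>k + h\<close>. If some pair \<open>{i,j}\<close> lies in no tight triangle,
  choose an \<open>h\<close>-dimensional \<open>W \<subseteq> U\<^sub>i\<^sub>j\<close>, delete \<open>j\<close>, and restrict to the complement of \<open>W\<close>: the sums
  over \<open>{i,j,a}\<close> are large enough to contain a new \<open>k\<close>-dimensional \<open>U\<^sub>i\<^sub>a\<close> orthogonal to \<open>W\<close>, and all
  pairs avoiding \<open>i\<close> are orthogonal to \<open>W\<close> already. Otherwise every pair lies in a tight triangle.
  Two subspaces of a tight triangle meet in dimension greater than \<open>k/2\<close>, so that triangle is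
  unique and the tight triangles form a Steiner triple system. The bound then follows by
  counting dimensions in an orthogonal family built from the tight triangles through two
  points \<open>p\<close> and \<open>u\<close>.
\<close>

section \<open>Finite-dimensional subspaces of real sequences\<close>

lemma sum_fun_apply: "(\<Sum>v\<in>A. f v) j = (\<Sum>v\<in>A. f v j)"
  for f :: "'a \<Rightarrow> 'b \<Rightarrow> real"
  by (induction A rule: infinite_finite_induct) auto

section \<open>Coordinate subspaces and their dimension\<close>

definition coord_vec :: "nat \<Rightarrow> nat \<Rightarrow> real" where
  "coord_vec i = (\<lambda>j. if j = i then 1 else 0)"

definition coord_space :: "nat set \<Rightarrow> (nat \<Rightarrow> real) set" where
  "coord_space C = {x. \<forall>i. i \<notin> C \<longrightarrow> x i = 0}"

lemma subspace_coord_space: "subspace (coord_space C)"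
  by (auto simp: subspace_def coord_space_def)

lemma real_space_eq_coord_space: "real_space t = coord_space {..<t}"
  by (auto simp: real_space_def coord_space_def)

lemma inj_coord_vec: "inj coord_vec"
  by (rule injI) (metis coord_vec_def zero_neq_one)

lemma coord_space_subset_span:
  assumes "finite C"
  shows "coord_space C \<subseteq> span (coord_vec ` C)"
proof
  fix x assume x: "x \<in> coord_space C"
  have "x = (\<Sum>i\<in>C. x i *\<^sub>R coord_vec i)"
  proof
    fix j
    have "(\<Sum>i\<in>C. x i *\<^sub>R coord_vec i) j = (\<Sum>i\<in>C. if j = i then x i else 0)"
      unfolding sum_fun_apply by (rule sum.cong) (auto simp: coord_vec_def)
    also have "\<dots> = x j" using x assms by (auto simp: coord_space_def)
    finally show "x j = (\<Sum>i\<in>C. x i *\<^sub>R coord_vec i) j" by simp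
  qed
  moreover have "(\<Sum>i\<in>C. x i *\<^sub>R coord_vec i) \<in> span (coord_vec ` C)"
    by (intro span_sum span_scale span_base) auto
  ultimately show "x \<in> span (coord_vec ` C)" by simp
qed

lemma independent_coord_vec:
  assumes "finite C"
  shows "independent (coord_vec ` C)"
proof (rule independent_if_scalars_zero)
  fix f v assume z: "(\<Sum>x\<in>coord_vec ` C. f x *\<^sub>R x) = 0" and "v \<in> coord_vec ` C"
  then obtain j where j: "j \<in> C" "v = coord_vec j" by auto
  have "0 = (\<Sum>i\<in>C. f (coord_vec i) *\<^sub>R coord_vec i) j"
    using z inj_coord_vec by (subst (asm) sum.reindex) (auto intro: inj_on_subset)
  also have "\<dots> = (\<Sum>i\<in>C. if j = i then f (coord_vec i) else 0)"
    unfolding sum_fun_apply by (rule sum.cong) (auto simp: coord_vec_def)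
  finally show "f v = 0" using j assms by simp
qed (use assms in simp)

lemma dim_coord_space:
  assumes "finite C"
  shows "dim (coord_space C) = card C"
proof (rule dim_unique)
  show "coord_vec ` C \<subseteq> coord_space C" by (auto simp: coord_vec_def coord_space_def)
  show "card (coord_vec ` C) = card C"
    by (metis card_image inj_coord_vec inj_on_subset subset_UNIV)
qed (use coord_space_subset_span independent_coord_vec assms in auto)

text \<open>All real sequences form an infinite-dimensional space, so finiteness of bases has to
  come from the \<open>t\<close> coordinate vectors that span the ambient space.\<close>

lemma finite_independent_real_space:
  assumes "independent B" "B \<subseteq> real_space t"
  shows "finite B"
proof -
  have "B \<subseteq> span (coord_vec ` {..<t})"
    using assms(2) coord_space_subset_span[of "{..<t}"] by (auto simp: real_space_eq_coord_space)
  then show ?thesis using independent_span_bound[OF _ assms(1)] by blast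
qed

lemma finite_basis_exists:
  assumes "V \<subseteq> real_space t"
  obtains B where "B \<subseteq> V" "independent B" "V \<subseteq> span B" "card B = dim V" "finite B"
  using basis_exists[of V] assms finite_independent_real_space by (metis order_trans)

lemma dim_mono_real_space:
  assumes "U \<subseteq> V" "V \<subseteq> real_space t"
  shows "dim U \<le> dim V"
  by (metis assms dim_le_card finite_basis_exists order_trans)

lemma choose_subspace:
  assumes "subspace V" "V \<subseteq> real_space t" "n \<le> dim V"
  obtains W where "subspace W" "W \<subseteq> V" "dim W = n"
proof -
  obtain B where B: "B \<subseteq> V" "independent B" "card B = dim V" "finite B"
    using finite_basis_exists[OF assms(2)] by metis
  then obtain C where C: "C \<subseteq> B" "card C = n"
    using assms(3) by (metis obtain_subset_with_card_n)
  show thesis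
  proof
    show "span C \<subseteq> V" using B C assms(1) by (intro span_minimal) auto
    show "dim (span C) = n"
      using B C by (metis dim_span_eq_card_independent independent_mono)
  qed simp
qed

text \<open>If a new \<open>v\<close> were \<open>x + y\<close> with \<open>x\<close> in
  \<open>span S\<close> and \<open>y\<close> in the span of the earlier part of \<open>T\<close>,
  then \<open>x = v - y\<close> would lie in both spans, hence vanish, and \<open>v\<close> would
  depend on that earlier part.\<close>

lemma independent_Un_if_span_disjoint:
  fixes S T :: "'a::real_vector set"
  assumes "finite T" "independent S" "independent T" "span S \<inter> span T \<subseteq> {0}"
  shows "independent (S \<union> T)"
  using assms
proof (induction T)
  case empty
  then show ?case by simp
next
  case (insert v T)
  have "span T \<subseteq> span (insert v T)" by (intro span_mono) auto
  moreover have v: "independent T" "v \<notin> span T"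
    using insert.prems(2) insert.hyps(2) by (simp_all add: independent_insert)
  ultimately have ind: "independent (S \<union> T)"
    using insert by blast
  have "v \<notin> span (S \<union> T)"
  proof
    assume "v \<in> span (S \<union> T)"
    then obtain x y where xy: "v = x + y" "x \<in> span S" "y \<in> span T"
      by (auto simp: span_Un)
    then have "x = v - y" by simp
    moreover have "v - y \<in> span (insert v T)"
      using xy \<open>span T \<subseteq> _\<close> by (intro span_diff) (auto simp: span_base)
    ultimately have "x = 0" using xy insert.prems(3) by auto
    then show False using xy v by simp
  qed
  with ind show ?case by (simp add: independent_insertI)
qed

lemma dim_add_le_if_disjoint:
  assumes "subspace U" "subspace W" "subspace V" "U \<subseteq> V" "W \<subseteq> V" "V \<subseteq> real_space t"
    and "U \<inter> W \<subseteq> {0}"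
  shows "dim U + dim W \<le> dim V"
proof -
  obtain A where A: "A \<subseteq> U" "independent A" "card A = dim U" "finite A"
    using finite_basis_exists[of U t] assms by (metis order_trans)
  obtain B where B: "B \<subseteq> W" "independent B" "card B = dim W" "finite B"
    using finite_basis_exists[of W t] assms by (metis order_trans)
  have sp: "span A \<inter> span B \<subseteq> {0}"
    using A B assms span_minimal[of A U] span_minimal[of B W] by blast
  have "A \<inter> B \<subseteq> span A \<inter> span B" by (auto simp: span_base)
  moreover have "0 \<notin> A" using A(2) dependent_zero by blast
  ultimately have "A \<inter> B = {}" using sp by auto
  then have "card (A \<union> B) = dim U + dim W" using A B by (simp add: card_Un_disjoint)
  moreover have "independent (A \<union> B)"
    using independent_Un_if_span_disjoint A B sp by blast
  then have "dim (A \<union> B) = card (A \<union> B)" by (rule dim_eq_card_independent)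
  moreover have "dim (A \<union> B) \<le> dim V"
    using A B assms by (intro dim_mono_real_space) auto
  ultimately show ?thesis by simp
qed

section \<open>Orthogonality and relative orthogonal complements\<close>

lemma std_inner_left_linear: "std_inner t (x + y) z = std_inner t x z + std_inner t y z"
  "std_inner t (c *\<^sub>R x) z = c * std_inner t x z" "std_inner t 0 z = 0"
  "std_inner t (x - y) z = std_inner t x z - std_inner t y z"
  by (simp_all add: std_inner_def algebra_simps sum.distrib sum_distrib_left sum_subtractf)

lemma std_inner_commute: "std_inner t x y = std_inner t y x"
  by (simp add: std_inner_def mult.commute)

lemma std_inner_eq_0_self:
  assumes "x \<in> real_space t" "std_inner t x x = 0"
  shows "x = 0"
proof
  fix i
  have "\<forall>i\<in>{..<t}. x i * x i = 0"
    using assms(2) unfolding std_inner_def by (subst (asm) sum_nonneg_eq_0_iff) auto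
  then show "x i = 0 i" using assms(1) by (cases "i < t") (auto simp: real_space_def)
qed

text \<open>The complement of \<open>W\<close> relative to \<open>V\<close>. As \<open>W\<close> may
  be any set, a finite basis can stand in for the subspace it spans.\<close>

definition orth_in :: "nat \<Rightarrow> (nat \<Rightarrow> real) set \<Rightarrow> (nat \<Rightarrow> real) set \<Rightarrow> (nat \<Rightarrow> real) set" where
  "orth_in t V W = {x \<in> V. \<forall>y\<in>W. std_inner t x y = 0}"

lemma orth_in_subset: "orth_in t V W \<subseteq> V"
  by (auto simp: orth_in_def)

lemma subspace_orth_in: "subspace V \<Longrightarrow> subspace (orth_in t V W)"
  by (auto simp: subspace_def orth_in_def std_inner_left_linear)

lemma std_inner_span_left:
  assumes "x \<in> span B" "\<And>b. b \<in> B \<Longrightarrow> std_inner t b y = 0"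
  shows "std_inner t x y = 0"
  using assms(1)
  by (induction rule: span_induct) (auto simp: subspace_def std_inner_left_linear assms(2))

lemma std_inner_span_right:
  assumes "y \<in> span B" "\<And>b. b \<in> B \<Longrightarrow> std_inner t x b = 0"
  shows "std_inner t x y = 0"
  using std_inner_span_left[OF assms(1), of t x] assms(2) by (simp add: std_inner_commute)

lemma orth_in_span: "orth_in t V B \<subseteq> orth_in t V (span B)"
  by (auto simp: orth_in_def intro: std_inner_span_right)

text \<open>Each vector of \<open>B\<close> imposes one linear condition, which lowers the dimension
  by at most one.\<close>

lemma dim_le_dim_orth_in_card:
  assumes "finite B" "subspace V" "V \<subseteq> real_space t"
  shows "dim V \<le> dim (orth_in t V B) + card B"
  using assms(1)
proof (induction B)
  case empty
  then show ?case by (simp add: orth_in_def)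
next
  case (insert b B)
  let ?K = "orth_in t V B" and ?K' = "orth_in t V (insert b B)"
  have "dim ?K \<le> dim ?K' + 1"
  proof (cases "?K \<subseteq> ?K'")
    case True
    then show ?thesis
      using dim_mono_real_space[of ?K ?K' t] assms(3) orth_in_subset[of t V] by (meson le_add1 order_trans)
  next
    case False
    then obtain z where z: "z \<in> ?K" "std_inner t z b \<noteq> 0"
      by (auto simp: orth_in_def)
    obtain D where D: "D \<subseteq> ?K'" "?K' \<subseteq> span D" "card D = dim ?K'" "finite D"
      using finite_basis_exists[of ?K' t] assms(3) orth_in_subset[of t V] by (metis order_trans)
    have "?K \<subseteq> span (insert z D)"
    proof
      fix x assume x: "x \<in> ?K"
      \<comment> \<open>This coefficient makes \<open>x - ?c *\<^sub>R z\<close> orthogonal to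
        \<open>b\<close>.\<close>
      let ?c = "std_inner t x b / std_inner t z b"
      have "x - ?c *\<^sub>R z \<in> ?K"
        using x z subspace_orth_in[OF assms(2)] by (intro subspace_diff subspace_scale) auto
      then have "x - ?c *\<^sub>R z \<in> ?K'"
        using z by (auto simp: orth_in_def std_inner_left_linear)
      then have "x - ?c *\<^sub>R z \<in> span (insert z D)"
        using D(2) span_mono[of D "insert z D"] by blast
      then have "(x - ?c *\<^sub>R z) + ?c *\<^sub>R z \<in> span (insert z D)"
        by (intro span_add span_scale[of z]) (auto simp: span_base)
      then show "x \<in> span (insert z D)" by simp
    qed
    then have "dim ?K \<le> card (insert z D)"
      using D(4) by (intro dim_le_card) auto
    also have "\<dots> \<le> dim ?K' + 1" using D by (simp add: card_insert_if)
    finally show ?thesis .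
  qed
  with insert show ?case by simp
qed

lemma dim_le_dim_orth_in:
  assumes "subspace V" "V \<subseteq> real_space t" "W \<subseteq> real_space t"
  shows "dim V \<le> dim (orth_in t V W) + dim W"
proof -
  obtain B where B: "W \<subseteq> span B" "card B = dim W" "finite B"
    using finite_basis_exists[OF assms(3)] by metis
  have "orth_in t V B \<subseteq> orth_in t V W"
    using orth_in_span[of t V B] B(1) by (auto simp: orth_in_def)
  then have "dim (orth_in t V B) \<le> dim (orth_in t V W)"
    by (rule dim_mono_real_space) (use assms(2) orth_in_subset in blast)
  with dim_le_dim_orth_in_card[OF B(3) assms(1,2)] B(2) show ?thesis by simp
qed

text \<open>Replacing \<open>W\<close> by the complement of \<open>U \<inter> W\<close> in it makes
  the intersection with \<open>U\<close> trivial, at a cost of at most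
  \<open>dim (U \<inter> W)\<close>.\<close>

lemma dim_add_le_dim_Int:
  assumes "subspace U" "subspace W" "subspace V" "U \<subseteq> V" "W \<subseteq> V" "V \<subseteq> real_space t"
  shows "dim U + dim W \<le> dim V + dim (U \<inter> W)"
proof -
  let ?W = "orth_in t W (U \<inter> W)"
  have "U \<inter> ?W \<subseteq> {0}"
    using assms by (auto simp: orth_in_def intro!: std_inner_eq_0_self[of _ t])
  then have "dim U + dim ?W \<le> dim V"
    using assms orth_in_subset[of t W "U \<inter> W"]
    by (intro dim_add_le_if_disjoint[where t = t] subspace_orth_in) auto
  moreover have "dim W \<le> dim ?W + dim (U \<inter> W)"
    using assms by (intro dim_le_dim_orth_in) auto
  ultimately show ?thesis by simp
qed

lemma orthogonal_subspaces_mono: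
  "orthogonal_subspaces t U W \<Longrightarrow> U' \<subseteq> U \<Longrightarrow> W' \<subseteq> W \<Longrightarrow> orthogonal_subspaces t U' W'"
  unfolding orthogonal_subspaces_def by blast

lemma orthogonal_subspaces_commute:
  "orthogonal_subspaces t U W \<Longrightarrow> orthogonal_subspaces t W U"
  unfolding orthogonal_subspaces_def by (metis std_inner_commute)

lemma dim_orth_in_add_le:
  assumes "subspace W" "subspace V" "W \<subseteq> V" "V \<subseteq> real_space t"
  shows "dim (orth_in t V W) + dim W \<le> dim V"
proof (rule dim_add_le_if_disjoint)
  show "orth_in t V W \<inter> W \<subseteq> {0}"
    using assms by (auto simp: orth_in_def intro!: std_inner_eq_0_self[of _ t])
qed (use assms subspace_orth_in orth_in_subset in auto)

text \<open>Peel off one member at a time: the others lie in its complement, whose dimension is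
  smaller by at least \<open>dim (G i)\<close>.\<close>

lemma sum_dim_le_if_pairwise_orthogonal:
  assumes "finite I" "subspace V" "V \<subseteq> real_space t"
    and "\<And>i. i \<in> I \<Longrightarrow> subspace (G i)" "\<And>i. i \<in> I \<Longrightarrow> G i \<subseteq> V"
    and "\<And>i j. i \<in> I \<Longrightarrow> j \<in> I \<Longrightarrow> i \<noteq> j \<Longrightarrow> orthogonal_subspaces t (G i) (G j)"
  shows "(\<Sum>i\<in>I. dim (G i)) \<le> dim V"
  using assms
proof (induction I arbitrary: V)
  case empty
  then show ?case by simp
next
  case (insert i I)
  let ?V = "orth_in t V (G i)"
  have "(\<Sum>j\<in>I. dim (G j)) \<le> dim ?V"
  proof (rule insert.IH)
    fix j assume j: "j \<in> I"
    then have "orthogonal_subspaces t (G j) (G i)" using insert.prems(5)[of j i] insert.hyps by auto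
    moreover have "G j \<subseteq> V" using insert.prems j by auto
    ultimately show "G j \<subseteq> ?V"
      unfolding orth_in_def orthogonal_subspaces_def by blast
  next
    show "?V \<subseteq> real_space t" using insert.prems(2) orth_in_subset by blast
  qed (simp_all add: insert.prems subspace_orth_in)
  moreover have "dim ?V + dim (G i) \<le> dim V"
    using insert.prems(1-4) by (intro dim_orth_in_add_le) simp_all
  ultimately show ?case using insert.hyps by simp
qed

section \<open>Tight triangles\<close>

definition pairs :: "'a set \<Rightarrow> 'a set set" where
  "pairs P = {e. e \<subseteq> P \<and> card e = 2}"

lemma insert_pair_in_pairs [simp]: "{x, y} \<in> pairs P \<longleftrightarrow> x \<in> P \<and> y \<in> P \<and> x \<noteq> y"
  by (auto simp: pairs_def card_2_iff doubleton_eq_iff)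

lemma pairsE:
  assumes "e \<in> pairs P"
  obtains x y where "e = {x, y}" "x \<in> P" "y \<in> P" "x \<noteq> y"
  using assms by (auto simp: pairs_def card_2_iff)

lemma pairs_mono: "P \<subseteq> Q \<Longrightarrow> pairs P \<subseteq> pairs Q"
  by (auto simp: pairs_def)

text \<open>
  The ambient space is an arbitrary subspace \<open>V\<close> of \<open>\<real>\<^sup>t\<close>, so that passing to the orthogonal
  complement of a subspace in the induction needs no change of coordinates.
\<close>

locale pair_representation =
  fixes t k :: nat and P :: "'a set" and V :: "(nat \<Rightarrow> real) set"
    and U :: "'a set \<Rightarrow> (nat \<Rightarrow> real) set"
  assumes subspace_V: "subspace V" and V_subset: "V \<subseteq> real_space t"
    and subspace_U: "e \<in> pairs P \<Longrightarrow> subspace (U e)"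
    and U_subset: "e \<in> pairs P \<Longrightarrow> U e \<subseteq> V"
    and dim_U: "e \<in> pairs P \<Longrightarrow> dim (U e) = k"
    and orthogonal_U: "e \<in> pairs P \<Longrightarrow> f \<in> pairs P \<Longrightarrow> e \<inter> f = {} \<Longrightarrow> orthogonal_subspaces t (U e) (U f)"
begin

definition span_on :: "'a set \<Rightarrow> (nat \<Rightarrow> real) set" where
  "span_on L = span (\<Union>e\<in>pairs L. U e)"

text \<open>The threshold serves both cases of the induction: a sum that reaches it keeps dimension
  \<open>k\<close> after a cut by \<open>(k + 1) div 2\<close>, and below it any two of the three
  subspaces overlap in more than \<open>k/2\<close>.\<close>

definition tight :: "'a \<Rightarrow> 'a \<Rightarrow> 'a \<Rightarrow> bool" where
  "tight i j a \<longleftrightarrow> {i, j, a} \<subseteq> P \<and> card {i, j, a} = 3 \<and> dim (span_on {i, j, a}) < k + (k + 1) div 2"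

lemma subspace_span_on: "subspace (span_on L)"
  by (simp add: span_on_def)

lemma span_on_subset: "L \<subseteq> P \<Longrightarrow> span_on L \<subseteq> V"
  unfolding span_on_def using U_subset pairs_mono subspace_V by (intro span_minimal) blast+

lemma U_subset_span_on: "e \<in> pairs L \<Longrightarrow> U e \<subseteq> span_on L"
  unfolding span_on_def by (auto intro: span_base)

lemma orthogonal_span_on:
  assumes "L \<subseteq> P" "f \<in> pairs P" "L \<inter> f = {}"
  shows "orthogonal_subspaces t (span_on L) (U f)"
  unfolding orthogonal_subspaces_def
proof (intro ballI)
  fix x y assume xy: "x \<in> span_on L" "y \<in> U f"
  show "std_inner t x y = 0"
    using xy(1) unfolding span_on_def
  proof (rule std_inner_span_left)
    fix b assume "b \<in> (\<Union>e\<in>pairs L. U e)"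
    then obtain e where e: "e \<in> pairs L" "b \<in> U e" by blast
    then have "e \<in> pairs P" "e \<inter> f = {}" using assms pairs_mono by (auto simp: pairs_def)
    from orthogonal_U[OF this(1) assms(2) this(2)] e xy show "std_inner t b y = 0"
      by (auto simp: orthogonal_subspaces_def)
  qed
qed

lemma subspace_U_Int:
  "e \<in> pairs P \<Longrightarrow> f \<in> pairs P \<Longrightarrow> subspace (U e \<inter> U f)"
  by (intro subspace_inter subspace_U)

lemma tight_rotate: "tight i j a \<Longrightarrow> tight j a i"
  by (auto simp: tight_def insert_commute)

lemma tight_swap: "tight i j a \<Longrightarrow> tight j i a"
  by (auto simp: tight_def insert_commute)

lemma tight_distinct: "tight i j a \<Longrightarrow> i \<noteq> j \<and> i \<noteq> a \<and> j \<noteq> a \<and> i \<in> P \<and> j \<in> P \<and> a \<in> P"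
  by (auto simp: tight_def card_insert_if split: if_splits)

text \<open>Two subspaces of dimension \<open>k\<close> in a sum of dimension at most
  \<open>k + (k + 1) div 2 - 1\<close> overlap this much. Rotating the triangle gives the other two
  overlaps.\<close>

lemma dim_Int_tight:
  assumes "tight i j a"
  shows "k div 2 + 1 \<le> dim (U {i, j} \<inter> U {i, a})"
proof -
  note d = tight_distinct[OF assms]
  have "dim (U {i, j}) + dim (U {i, a}) \<le> dim (span_on {i, j, a}) + dim (U {i, j} \<inter> U {i, a})"
    using d span_on_subset[of "{i, j, a}"] V_subset
    by (intro dim_add_le_dim_Int[where t = t] subspace_U subspace_span_on U_subset_span_on) auto
  then show ?thesis using assms d by (auto simp: dim_U tight_def)
qed

text \<open>Otherwise \<open>{i, a}\<close> and \<open>{j, b}\<close> are disjoint, so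
  \<open>U {i, j}\<close> contains two orthogonal subspaces of dimension above \<open>k/2\<close>
  each.\<close>

lemma tight_unique:
  assumes "tight i j a" "tight i j b"
  shows "a = b"
proof (rule ccontr)
  assume ab: "a \<noteq> b"
  note d = tight_distinct[OF assms(1)] tight_distinct[OF assms(2)]
  let ?A = "U {i, j} \<inter> U {i, a}" and ?B = "U {j, i} \<inter> U {j, b}"
  have "orthogonal_subspaces t (U {i, a}) (U {j, b})"
    using d ab by (intro orthogonal_U) auto
  then have "orthogonal_subspaces t ?A ?B" by (rule orthogonal_subspaces_mono) auto
  moreover have "U {i, j} \<subseteq> real_space t" using U_subset V_subset d by force
  ultimately have "?A \<inter> ?B \<subseteq> {0}"
    by (auto simp: orthogonal_subspaces_def intro!: std_inner_eq_0_self[of _ t])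
  then have "dim ?A + dim ?B \<le> dim (U {i, j})"
    using d \<open>U {i, j} \<subseteq> real_space t\<close>
    by (intro dim_add_le_if_disjoint[where t = t] subspace_U_Int subspace_U) (auto simp: insert_commute)
  then show False
    using dim_Int_tight[OF assms(1)] dim_Int_tight[OF tight_swap[OF assms(2)]] d by (simp add: dim_U)
qed

lemma remove_point:
  assumes "i \<in> P" "j \<in> P" "i \<noteq> j" and no_tight: "\<And>a. \<not> tight i j a"
  obtains V' U' where "pair_representation t k (P - {j}) V' U'" "dim V' + (k + 1) div 2 \<le> dim V"
proof -
  let ?h = "(k + 1) div 2"
  have ij: "{i, j} \<in> pairs P" using assms by simp
  have "?h \<le> dim (U {i, j})" using dim_U[OF ij] by simp
  then obtain W where W: "subspace W" "W \<subseteq> U {i, j}" "dim W = ?h"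
    using choose_subspace[of "U {i, j}" t ?h] subspace_U[OF ij] U_subset[OF ij] V_subset by auto
  have WV: "W \<subseteq> V" using W(2) U_subset[OF ij] by simp
  define V' where "V' = orth_in t V W"
  have V': "subspace V'" "V' \<subseteq> V" "dim V' + ?h \<le> dim V"
    using dim_orth_in_add_le[OF W(1) subspace_V WV V_subset] W(3)
    by (simp_all add: V'_def subspace_orth_in subspace_V orth_in_subset)
  \<comment> \<open>A new subspace for a pair \<open>e\<close> through \<open>i\<close> is taken
    inside the triangle sum, so it stays orthogonal to \<open>U f\<close> whenever \<open>f\<close>
    avoids \<open>insert j e\<close>; for \<open>f\<close> without \<open>j\<close> this only means
    disjointness from \<open>e\<close>.\<close>
  have "\<exists>T. subspace T \<and> T \<subseteq> span_on (insert j e) \<and> T \<subseteq> V' \<and> dim T = k"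
    if e: "e \<in> pairs (P - {j})" "i \<in> e" for e
  proof -
    from e obtain a where a: "e = {i, a}" "a \<in> P" "a \<noteq> i" "a \<noteq> j"
      by (elim pairsE) auto
    let ?S = "span_on (insert j e)" and ?S' = "orth_in t (span_on (insert j e)) W"
    have eP: "insert j e \<subseteq> P" "insert j e = {i, j, a}" using a assms by auto
    have SV: "?S \<subseteq> V" "?S \<subseteq> real_space t" using span_on_subset[OF eP(1)] V_subset by auto
    have "card {i, j, a} = 3" using a assms by simp
    then have "k + ?h \<le> dim ?S"
      using no_tight[of a] eP by (simp add: tight_def not_less)
    moreover have "dim ?S \<le> dim ?S' + dim W"
      using SV WV V_subset by (intro dim_le_dim_orth_in subspace_span_on) auto
    ultimately have "k \<le> dim ?S'" using W(3) by simp
    moreover have "?S' \<subseteq> real_space t" using orth_in_subset SV by blast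
    ultimately obtain T where "subspace T" "T \<subseteq> ?S'" "dim T = k"
      using choose_subspace[of ?S' t k] subspace_orth_in[OF subspace_span_on] by metis
    then show ?thesis using SV by (auto simp: orth_in_def V'_def)
  qed
  then obtain T where T: "\<And>e. e \<in> pairs (P - {j}) \<Longrightarrow> i \<in> e \<Longrightarrow>
      subspace (T e) \<and> T e \<subseteq> span_on (insert j e) \<and> T e \<subseteq> V' \<and> dim (T e) = k"
    by metis
  define U' where "U' e = (if i \<in> e then T e else U e)" for e
  have old: "e \<in> pairs P" if "e \<in> pairs (P - {j})" for e
    using that by (auto simp: pairs_def)
  have "orthogonal_subspaces t (T e) (U f)"
    if "e \<in> pairs (P - {j})" "f \<in> pairs (P - {j})" "i \<in> e" "e \<inter> f = {}" for e f
  proof (rule orthogonal_subspaces_mono)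
    show "orthogonal_subspaces t (span_on (insert j e)) (U f)"
      using that assms by (intro orthogonal_span_on old) (auto simp: pairs_def)
    show "T e \<subseteq> span_on (insert j e)" using T that by blast
  qed simp
  note orth_T = this
  have "pair_representation t k (P - {j}) V' U'"
  proof
    fix e assume e: "e \<in> pairs (P - {j})"
    show "subspace (U' e)" "dim (U' e) = k"
      using T[OF e] subspace_U dim_U old[OF e] by (auto simp: U'_def)
    show "U' e \<subseteq> V'"
    proof (cases "i \<in> e")
      case True
      then show ?thesis using T[OF e] by (simp add: U'_def)
    next
      case False
      then have "orthogonal_subspaces t (U e) (U {i, j})"
        using e by (intro orthogonal_U old ij) (auto simp: pairs_def)
      then show ?thesis
        using False U_subset[OF old[OF e]] W(2)
        by (auto simp: U'_def V'_def orth_in_def orthogonal_subspaces_def)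
    qed
  next
    fix e f assume ef: "e \<in> pairs (P - {j})" "f \<in> pairs (P - {j})" "e \<inter> f = {}"
    \<comment> \<open>Two pairs through \<open>i\<close> meet, so of two disjoint pairs at most one
      carries a new subspace.\<close>
    then show "orthogonal_subspaces t (U' e) (U' f)"
      using orth_T[of e f] orth_T[of f e] orthogonal_U[of e f] old
      by (auto simp: U'_def intro: orthogonal_subspaces_commute)
  qed (use V' V_subset in auto)
  then show thesis using V'(3) that by blast
qed

end

section \<open>The case of a Steiner triple system\<close>

locale steiner_representation = pair_representation +
  assumes finite_P: "finite P"
    and tight_exists: "i \<in> P \<Longrightarrow> j \<in> P \<Longrightarrow> i \<noteq> j \<Longrightarrow> \<exists>a. tight i j a"
begin

text \<open>Blocks of the triple system through \<open>p\<close>, with \<open>p\<close> removed,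
  whose other points avoid \<open>L\<close>. Below, \<open>L\<close> is itself a block through
  \<open>p\<close>.\<close>

definition opposite_pairs :: "'a \<Rightarrow> 'a set \<Rightarrow> 'a set set" where
  "opposite_pairs p L = {{x, y} | x y. tight p x y \<and> x \<notin> L \<and> y \<notin> L}"

lemma opposite_pairs_subset: "opposite_pairs p L \<subseteq> pairs (P - L)"
  by (auto simp: opposite_pairs_def dest!: tight_distinct)

lemma finite_opposite_pairs: "finite (opposite_pairs p L)"
proof (rule finite_subset)
  show "opposite_pairs p L \<subseteq> Pow P" using opposite_pairs_subset by (fastforce simp: pairs_def)
qed (simp add: finite_P)

lemma opposite_pairs_tight:
  assumes "{x, y} \<in> opposite_pairs p L"
  shows "tight p x y"
proof -
  obtain a b where ab: "{x, y} = {a, b}" "tight p a b"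
    using assms by (auto simp: opposite_pairs_def)
  have "tight p b a" using tight_rotate[OF tight_swap[OF ab(2)]] .
  then show ?thesis using ab by (auto simp: doubleton_eq_iff)
qed

text \<open>A common point \<open>x\<close> of two such pairs would put \<open>{p, x}\<close> in two
  tight triangles.\<close>

lemma opposite_pairs_disjoint:
  assumes "e \<in> opposite_pairs p L" "f \<in> opposite_pairs p L" "e \<noteq> f"
  shows "e \<inter> f = {}"
proof (rule ccontr)
  assume "e \<inter> f \<noteq> {}"
  then obtain x where x: "x \<in> e" "x \<in> f" by auto
  obtain y where y: "e = {x, y}"
    using assms(1) x(1) by (auto simp: opposite_pairs_def)
  obtain z where z: "f = {x, z}"
    using assms(2) x(2) by (auto simp: opposite_pairs_def)
  show False
    using assms y z opposite_pairs_tight tight_unique by metis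
qed

text \<open>Each point outside \<open>L\<close> lies with \<open>p\<close> in exactly one block, and
  that block meets \<open>L\<close> only in \<open>p\<close>, so the pairs partition
  \<open>P - L\<close>.\<close>

lemma card_opposite_pairs:
  assumes "tight p u w" "L = {p, u, w}"
  shows "2 * card (opposite_pairs p L) + 3 = card P"
proof -
  note d = tight_distinct[OF assms(1)]
  have un: "\<Union>(opposite_pairs p L) = P - L"
  proof
    show "\<Union>(opposite_pairs p L) \<subseteq> P - L" using opposite_pairs_subset by (auto simp: pairs_def)
    show "P - L \<subseteq> \<Union>(opposite_pairs p L)"
    proof
      fix x assume x: "x \<in> P - L"
      then obtain y where y: "tight p x y" using tight_exists[of p x] d assms(2) by blast
      have "y \<noteq> u"
        using tight_unique[OF assms(1), of x] y x assms(2) tight_rotate tight_swap by blast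
      moreover have "y \<noteq> w"
        using tight_unique[of p w u x] y x assms tight_rotate tight_swap by blast
      ultimately have "{x, y} \<in> opposite_pairs p L"
        using x y tight_distinct[OF y] assms(2) by (auto simp: opposite_pairs_def)
      then show "x \<in> \<Union>(opposite_pairs p L)" by blast
    qed
  qed
  have "2 * card (opposite_pairs p L) = card (\<Union>(opposite_pairs p L))"
  proof (rule card_partition)
    show "finite (\<Union>(opposite_pairs p L))" using un finite_P by simp
    show "card e = 2" if "e \<in> opposite_pairs p L" for e
      using that opposite_pairs_subset by (auto simp: pairs_def)
  qed (use finite_opposite_pairs opposite_pairs_disjoint in auto)
  moreover have "card (P - L) + 3 = card P"
    using d assms(2) finite_P card_mono[of P L] by (subst card_Diff_subset) auto
  ultimately show ?thesis using un by simp
qed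

text \<open>Inside \<open>U {x, y}\<close>, of dimension \<open>k\<close>, the two overlaps have
  dimension at least \<open>k div 2 + 1\<close> each, which adds up to more than
  \<open>k\<close>.\<close>

lemma dim_triple_Int_tight:
  assumes "tight u x y"
  shows "1 \<le> dim (U {x, y} \<inter> (U {u, x} \<inter> U {u, y}))"
proof -
  note d = tight_distinct[OF assms]
  let ?A = "U {x, y} \<inter> U {x, u}" and ?B = "U {y, u} \<inter> U {y, x}"
  have "tight x y u" "tight y u x" using assms tight_rotate by blast+
  note this[THEN dim_Int_tight]
  moreover have "dim ?A + dim ?B \<le> dim (U {x, y}) + dim (?A \<inter> ?B)"
    using d U_subset[of "{x, y}"] V_subset
    by (intro dim_add_le_dim_Int[where t = t] subspace_U_Int subspace_U) (auto simp: insert_commute)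
  moreover have "?A \<inter> ?B = U {x, y} \<inter> (U {u, x} \<inter> U {u, y})"
    by (auto simp: insert_commute)
  ultimately show ?thesis using d by (simp add: dim_U)
qed

text \<open>The orthogonal family contributes \<open>k\<close> for \<open>{p, w}\<close> and for
  each pair in \<open>Cp\<close>, at least \<open>k div 2 + 1\<close> for one pair in
  \<open>Cu\<close>, and at least 1 for each other pair in \<open>Cu\<close>.\<close>

lemma dim_ge:
  assumes "card P \<ge> 5"
  shows "(k + 1) div 2 * (card P - 4) + 2 * k \<le> dim V"
proof -
  have "2 \<le> card P" using assms by simp
  then obtain Q where "Q \<subseteq> P" "card Q = 2" by (rule obtain_subset_with_card_n)
  then obtain p u where pu: "p \<in> P" "u \<in> P" "p \<noteq> u"
    by (auto simp: card_2_iff)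
  then obtain w where w: "tight p u w" using tight_exists by blast
  note d = tight_distinct[OF w]
  define L where "L = {p, u, w}"
  define Cp where "Cp = opposite_pairs p L"
  define Cu where "Cu = opposite_pairs u L"
  have cp: "2 * card Cp + 3 = card P" unfolding Cp_def by (rule card_opposite_pairs[OF w L_def])
  have cu: "2 * card Cu + 3 = card P" unfolding Cu_def
    by (rule card_opposite_pairs[OF tight_swap[OF w]]) (auto simp: L_def)
  have fin: "finite Cp" "finite Cu" by (simp_all add: Cp_def Cu_def finite_opposite_pairs)
  have sub: "Cp \<subseteq> pairs (P - L)" "Cu \<subseteq> pairs (P - L)"
    using opposite_pairs_subset by (simp_all add: Cp_def Cu_def)
  have "Cu \<noteq> {}" using cu assms by auto
  then obtain f1 where f1: "f1 \<in> Cu" by blast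
  have disj: "Cp \<inter> Cu = {}"
  proof (rule ccontr)
    assume "Cp \<inter> Cu \<noteq> {}"
    then obtain e where e: "e \<in> Cp" "e \<in> Cu" by blast
    then obtain x y where xy: "e = {x, y}" using sub by (blast elim: pairsE)
    then have "tight p x y" "tight u x y"
      using e opposite_pairs_tight by (auto simp: Cp_def Cu_def)
    then have "p = u" using tight_unique[of x y p u] tight_rotate by blast
    then show False using pu by simp
  qed
  \<comment> \<open>This pair inside \<open>L\<close> avoids \<open>u\<close>, so it is disjoint
    from all pairs outside \<open>L\<close> and from \<open>{u, x}\<close> for every
    \<open>x\<close> outside \<open>L\<close>.\<close>
  let ?e0 = "{p, w}"
  have e0: "?e0 \<notin> Cp" "?e0 \<notin> Cu" "?e0 \<in> pairs P"
    using sub d by (auto simp: L_def pairs_def)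
  \<comment> \<open>Off \<open>Cu\<close> the pairs are disjoint and contribute \<open>k\<close> each. A pair \<open>{x, y}\<close> in \<open>Cu\<close> contributes
    its triple intersection with \<open>U {u, x}\<close> and \<open>U {u, y}\<close>, but for the single pair \<open>f1\<close> the
    larger \<open>U {u, x} \<inter> U {u, y}\<close> is still orthogonal to the rest.\<close>
  define G where "G e = (if e \<in> Cu then (if e = f1 then V else U e) \<inter> (\<Inter>x\<in>e. U {u, x}) else U e)" for e
  let ?I = "insert ?e0 Cp \<union> Cu"
  have IP: "e \<in> pairs P" if "e \<in> ?I" for e
    using that e0 sub pairs_mono[of "P - L" P] by blast
  have ux: "{u, x} \<in> pairs P" if "e \<in> Cu" "x \<in> e" for e x
  proof -
    have "x \<in> P - L" using that sub(2) unfolding pairs_def by blast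
    then show ?thesis using d by (auto simp: L_def)
  qed
  have GU: "G e \<subseteq> U {u, x}" if "e \<in> Cu" "x \<in> e" for e x
    using that by (auto simp: G_def)
  have sub_G: "subspace (G e)" "G e \<subseteq> V" if e: "e \<in> ?I" for e
  proof -
    show "subspace (G e)"
    proof (cases "e \<in> Cu")
      case True
      have "subspace (\<Inter>x\<in>e. U {u, x})"
        using True ux by (intro subspace_Inter) (auto intro!: subspace_U)
      then show ?thesis
        using True subspace_V subspace_U[OF IP[OF e]] by (auto simp: G_def intro: subspace_inter)
    qed (use subspace_U[OF IP[OF e]] in \<open>simp add: G_def\<close>)
    show "G e \<subseteq> V" using U_subset[OF IP[OF e]] by (auto simp: G_def)
  qed
  have orth_old: "orthogonal_subspaces t (G e) (G f)"
    if "e \<in> insert ?e0 Cp" "f \<in> insert ?e0 Cp" "e \<noteq> f" for e f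
  proof -
    have "e \<inter> f = {}"
      using that sub opposite_pairs_disjoint[of e p L f] by (auto simp: Cp_def L_def pairs_def)
    then show ?thesis
      using that orthogonal_U[of e f] IP e0 disj by (auto simp: G_def)
  qed
  \<comment> \<open>Some \<open>x\<close> in \<open>f\<close> is not in \<open>e\<close>. Then
    \<open>{u, x}\<close> is disjoint from \<open>e\<close>, and \<open>G f\<close> lies in
    \<open>U {u, x}\<close>.\<close>
  have orth_mixed: "orthogonal_subspaces t (G f) (G e)" if e: "e \<in> insert ?e0 Cp" and f: "f \<in> Cu" for e f
  proof -
    have ne: "e \<noteq> f" using e f disj e0 by blast
    have "u \<notin> e" using e sub d by (auto simp: L_def pairs_def)
    moreover have "\<not> f \<subseteq> e"
    proof
      assume "f \<subseteq> e"
      moreover have "card e = 2" "card f = 2" using IP[of e] IP[of f] e f by (auto simp: pairs_def)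
      ultimately have "f = e" by (metis card_subset_eq card.infinite zero_neq_numeral)
      then show False using ne by simp
    qed
    then obtain x where x: "x \<in> f" "x \<notin> e" by blast
    ultimately have "orthogonal_subspaces t (U {u, x}) (U e)"
      using e f ux IP by (intro orthogonal_U) auto
    moreover have "G e = U e" using e disj e0 by (auto simp: G_def)
    ultimately show ?thesis using GU[OF f x(1)] by (auto intro: orthogonal_subspaces_mono)
  qed
  \<comment> \<open>Only one of the two spaces has to lie in its own \<open>U f\<close>; the other
    lies in some \<open>U {u, x}\<close> with \<open>{u, x}\<close> disjoint from \<open>f\<close>.
    Of two distinct pairs, one differs from \<open>f1\<close>.\<close>
  have orth_new: "orthogonal_subspaces t (G e) (G f)" if e: "e \<in> Cu" and f: "f \<in> Cu" "e \<noteq> f" "f \<noteq> f1" for e f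
  proof -
    have ef: "e \<inter> f = {}" using that opposite_pairs_disjoint by (auto simp: Cu_def)
    obtain x y where xy: "e = {x, y}" using e sub by (blast elim: pairsE)
    have "u \<notin> f" using f sub by (auto simp: L_def pairs_def)
    then have "orthogonal_subspaces t (U {u, x}) (U f)"
      using ux[of e x] IP[of f] ef xy e f by (intro orthogonal_U) auto
    moreover have "G f \<subseteq> U f" using f by (auto simp: G_def)
    ultimately show ?thesis using GU[OF e, of x] xy by (auto intro: orthogonal_subspaces_mono)
  qed
  have "(\<Sum>e\<in>?I. dim (G e)) \<le> dim V"
  proof (rule sum_dim_le_if_pairwise_orthogonal)
    fix e f assume ef: "e \<in> ?I" "f \<in> ?I" "e \<noteq> f"
    consider "e \<in> insert ?e0 Cp" "f \<in> insert ?e0 Cp" | "e \<in> insert ?e0 Cp" "f \<in> Cu"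
      | "e \<in> Cu" "f \<in> insert ?e0 Cp" | "e \<in> Cu" "f \<in> Cu" "f \<noteq> f1" | "e \<in> Cu" "f \<in> Cu" "e \<noteq> f1"
      using ef by blast
    then show "orthogonal_subspaces t (G e) (G f)"
      using ef orth_old orth_mixed orth_new orthogonal_subspaces_commute by cases metis+
  qed (use fin subspace_V V_subset sub_G in auto)
  moreover have "(\<Sum>e\<in>?I. dim (G e)) = (\<Sum>e\<in>insert ?e0 Cp. dim (G e)) + (\<Sum>e\<in>Cu. dim (G e))"
    using fin e0 disj by (intro sum.union_disjoint) auto
  moreover have "(\<Sum>e\<in>insert ?e0 Cp. dim (G e)) = (\<Sum>e\<in>insert ?e0 Cp. k)"
  proof (rule sum.cong)
    fix e assume e: "e \<in> insert ?e0 Cp"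
    then have "G e = U e" using disj e0 by (auto simp: G_def)
    then show "dim (G e) = k" using IP[of e] dim_U[of e] e by auto
  qed simp
  moreover have "(\<Sum>e\<in>insert ?e0 Cp. k) = k * (1 + card Cp)"
    using fin e0 by simp
  moreover have "(\<Sum>e\<in>Cu. dim (G e)) = dim (G f1) + (\<Sum>e\<in>Cu - {f1}. dim (G e))"
    using fin f1 by (intro sum.remove) auto
  moreover have "k div 2 + 1 \<le> dim (G f1)"
  proof -
    obtain x y where xy: "f1 = {x, y}" using f1 sub by (blast elim: pairsE)
    then have "tight u x y" using f1 opposite_pairs_tight by (auto simp: Cu_def)
    \<comment> \<open>The factor \<open>V\<close> in \<open>G f1\<close> is absorbed, since
      \<open>U {u, x}\<close> lies in \<open>V\<close>.\<close>
    moreover have "G f1 = U {u, x} \<inter> U {u, y}"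
      using f1 xy U_subset[OF ux[OF f1, of x]] by (auto simp: G_def)
    ultimately show ?thesis using dim_Int_tight by simp
  qed
  moreover have "(\<Sum>e\<in>Cu - {f1}. 1) \<le> (\<Sum>e\<in>Cu - {f1}. dim (G e))"
  proof (rule sum_mono)
    fix e assume e: "e \<in> Cu - {f1}"
    then obtain x y where xy: "e = {x, y}" using sub by (blast elim: pairsE)
    then have "tight u x y" using e opposite_pairs_tight by (auto simp: Cu_def)
    moreover have "G e = U {x, y} \<inter> (U {u, x} \<inter> U {u, y})"
      using e xy by (auto simp: G_def)
    ultimately show "1 \<le> dim (G e)" using dim_triple_Int_tight by simp
  qed
  moreover have "(\<Sum>e\<in>Cu - {f1}. 1) + 1 = card Cu"
    using f1 fin \<open>Cu \<noteq> {}\<close> card_gt_0_iff[of Cu] by simp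
  ultimately have "k * (1 + card Cp) + k div 2 + card Cu \<le> dim V" by linarith
  moreover define c where "c = card Cp - 1"
  then have c: "card Cp = c + 1" "card Cu = c + 1" "card P - 4 = 2 * c + 1"
    using cp cu assms by simp_all
  ultimately have le: "k * (c + 2) + k div 2 + c + 1 \<le> dim V" by simp
  \<comment> \<open>For odd \<open>k\<close> the count equals the bound exactly; for even
    \<open>k\<close> it exceeds it by \<open>c + 1\<close>.\<close>
  show ?thesis
  proof (cases "even k")
    case True
    then obtain m where "k = 2 * m" by blast
    then show ?thesis using le c by (simp add: algebra_simps)
  next
    case False
    then obtain m where "k = 2 * m + 1" by (blast elim: oddE)
    then show ?thesis using le c by (simp add: algebra_simps)
  qed
qed

end

text \<open>\<open>V\<close> and \<open>U\<close> vary in the induction because removing a point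
  replaces both. The Steiner case needs no induction hypothesis.\<close>

theorem (in pair_representation) dim_lower_bound:
  assumes "finite P" "card P \<ge> 4"
  shows "(k + 1) div 2 * (card P - 4) + 2 * k \<le> dim V"
  using assms pair_representation_axioms
proof (induction "card P" arbitrary: P V U)
  case 0
  then show ?case by simp
next
  case (Suc n)
  interpret R: pair_representation t k P V U by fact
  show ?case
  proof (cases "n = 3")
    case True
    then have "card P = 4" using Suc.hyps by simp
    then have "2 \<le> card P" by simp
    \<comment> \<open>On four points, a pair and its complement already force dimension
      \<open>2 * k\<close>.\<close>
    then obtain Q where Q: "Q \<subseteq> P" "card Q = 2" by (rule obtain_subset_with_card_n)
    then have e: "Q \<in> pairs P" "P - Q \<in> pairs P"
      using Suc.prems(1) \<open>card P = 4\<close> by (auto simp: pairs_def card_Diff_subset finite_subset)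
    have "(\<Sum>e\<in>{Q, P - Q}. dim (U e)) \<le> dim V"
    proof (rule sum_dim_le_if_pairwise_orthogonal)
      fix e f assume "e \<in> {Q, P - Q}" "f \<in> {Q, P - Q}" "e \<noteq> f"
      then show "orthogonal_subspaces t (U e) (U f)" using e by (intro R.orthogonal_U) auto
    qed (use e R.subspace_V R.V_subset R.subspace_U R.U_subset in auto)
    moreover have "Q \<noteq> P - Q" using Q(2) by (metis Diff_disjoint Int_absorb card.empty zero_neq_numeral)
    ultimately show ?thesis using e R.dim_U \<open>card P = 4\<close> by simp
  next
    case False
    then have n: "card P = Suc n" "n \<ge> 4" using Suc by auto
    show ?thesis
    proof (cases "\<forall>i\<in>P. \<forall>j\<in>P. i \<noteq> j \<longrightarrow> (\<exists>a. R.tight i j a)")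
      case True
      then interpret S: steiner_representation t k P V U
        using Suc.prems(1) by unfold_locales simp_all
      show ?thesis using S.dim_ge n by simp
    next
      case False
      then obtain i j where ij: "i \<in> P" "j \<in> P" "i \<noteq> j" "\<And>a. \<not> R.tight i j a" by blast
      then obtain V' U' where V': "pair_representation t k (P - {j}) V' U'" "dim V' + (k + 1) div 2 \<le> dim V"
        using R.remove_point by metis
      have "card (P - {j}) = n" using n ij Suc.prems(1) by simp
      then have "(k + 1) div 2 * (n - 4) + 2 * k \<le> dim V'"
        using Suc.hyps(1)[of "P - {j}" V' U'] V'(1) Suc.prems n by simp
      moreover have "card P - 4 = (n - 4) + 1" using n by simp
      ultimately show ?thesis using V'(2) by (simp add: algebra_simps)
    qed
  qed
qed

section \<open>Multicolourings\<close>

lemma orthogonal_coord_spaces: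
  "C \<inter> D = {} \<Longrightarrow> orthogonal_subspaces t (coord_space C) (coord_space D)"
  unfolding orthogonal_subspaces_def std_inner_def coord_space_def
  by (intro ballI sum.neutral) force

text \<open>Numbering the colours as coordinates turns disjoint colour sets into orthogonal
  coordinate subspaces.\<close>

lemma orthogonal_subspace_representation_of_multicolouring:
  assumes "finite Q"
    and "\<And>v. v \<in> pverts G \<Longrightarrow> C v \<subseteq> Q" "\<And>v. v \<in> pverts G \<Longrightarrow> card (C v) = k"
    and "\<And>v w. (v, w) \<in> parcs G \<Longrightarrow> C v \<inter> C w = {}"
    and "\<And>v w. (v, w) \<in> parcs G \<Longrightarrow> v \<in> pverts G \<and> w \<in> pverts G"
  shows "\<exists>U. orthogonal_subspace_representation (card Q) k G U"
proof -
  obtain h where h: "bij_betw h Q {..<card Q}"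
    using ex_bij_betw_finite_nat[OF assms(1)] by (auto simp: atLeast0LessThan)
  then have inj: "inj_on h Q" and img: "h ` Q = {..<card Q}" by (auto simp: bij_betw_def)
  define U where "U v = coord_space (h ` C v)" for v
  have "subspace (U v) \<and> U v \<subseteq> real_space (card Q) \<and> dim (U v) = k" if v: "v \<in> pverts G" for v
  proof -
    have sub: "h ` C v \<subseteq> {..<card Q}" using assms(2)[OF v] img by blast
    have "card (h ` C v) = k"
      using assms(2,3)[OF v] inj by (metis card_image inj_on_subset)
    then have "dim (U v) = k"
      using dim_coord_space[of "h ` C v"] finite_subset[OF sub] by (simp add: U_def)
    moreover have "U v \<subseteq> real_space (card Q)"
      using sub by (fastforce simp: U_def real_space_def coord_space_def)
    ultimately show ?thesis by (simp add: U_def subspace_coord_space)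
  qed
  moreover have "orthogonal_subspaces (card Q) (U v) (U w)" if "(v, w) \<in> parcs G" for v w
  proof -
    have "h ` C v \<inter> h ` C w = h ` (C v \<inter> C w)"
      using assms(2,5) that by (intro inj_on_image_Int[OF inj, symmetric]) auto
    then show ?thesis using assms(4)[OF that] by (auto simp: U_def intro: orthogonal_coord_spaces)
  qed
  ultimately show ?thesis
    unfolding orthogonal_subspace_representation_def by blast
qed

text \<open>Pairs of equal colour below \<open>d - 2\<close> share their minimum; pairs of colour
  \<open>d - 2\<close> lie in the three points \<open>d - 2\<close>, \<open>d - 1\<close>,
  \<open>d\<close> and so meet.\<close>

lemma min_colouring_disjoint:
  fixes d :: nat
  assumes "e \<in> pairs {1..d}" "f \<in> pairs {1..d}" "e \<inter> f = {}" "d \<ge> 2"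
  shows "min (Min e) (d - 2) \<noteq> min (Min f) (d - 2)"
proof
  assume eq: "min (Min e) (d - 2) = min (Min f) (d - 2)"
  obtain a b where e: "e = {a, b}" "a < b" "b \<le> d"
    using assms(1) by (elim pairsE) (metis atLeastAtMost_iff insert_commute linorder_less_linear)
  obtain x y where f: "f = {x, y}" "x < y" "y \<le> d"
    using assms(2) by (elim pairsE) (metis atLeastAtMost_iff insert_commute linorder_less_linear)
  have "a \<noteq> x" "a \<noteq> y" "b \<noteq> x" "b \<noteq> y" using assms(3) e f by auto
  then show False using eq e f assms(4) by auto
qed

lemma kneser_representation_exists:
  fixes k d :: nat
  assumes "d \<ge> 4"
  shows "\<exists>U. orthogonal_subspace_representation ((k + 1) div 2 * (d - 4) + 2 * k) k (kneser_graph d 2) U"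
proof -
  define m where "m = k div 2"
  \<comment> \<open>The label \<open>m\<close> of the extra colours is distinct from the private
    labels \<open>{..<m}\<close> and is present only for odd \<open>k\<close>.\<close>
  define X where "X = (if odd k then {m} else {})"
  define Q where "Q = {1..d} \<times> {..<m} \<union> {1..d - 2} \<times> X"
  define C where "C e = e \<times> {..<m} \<union> {min (Min e) (d - 2)} \<times> X" for e :: "nat set"
  have X: "finite X" "card X = k mod 2" "X \<inter> {..<m} = {}"
    by (auto simp: X_def odd_iff_mod_2_eq_one)
  have k: "2 * m + card X = k" "(k + 1) div 2 = m + card X" unfolding X(2) m_def by presburger+
  have "card Q = d * m + (d - 2) * card X"
    unfolding Q_def using X by (subst card_Un_disjoint) auto
  also have "\<dots> = (k + 1) div 2 * (d - 4) + 2 * k"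
  proof -
    obtain c where "d = c + 4" using assms by (metis le_Suc_ex add.commute)
    then show ?thesis unfolding k(2) unfolding k(1)[symmetric] by (simp add: algebra_simps)
  qed
  finally have cQ: "card Q = \<dots>" .
  have pv: "pverts (kneser_graph d 2) = pairs {1..d}"
    by (auto simp: kneser_graph_def pairs_def)
  have pa: "(e, f) \<in> parcs (kneser_graph d 2) \<longleftrightarrow> e \<in> pairs {1..d} \<and> f \<in> pairs {1..d} \<and> e \<inter> f = {}" for e f
    by (auto simp: kneser_graph_def pairs_def)
  have "\<exists>U. orthogonal_subspace_representation (card Q) k (kneser_graph d 2) U"
  proof (rule orthogonal_subspace_representation_of_multicolouring)
    show "finite Q" using X by (simp add: Q_def)
    fix e assume "e \<in> pverts (kneser_graph d 2)"
    then have e: "e \<subseteq> {1..d}" "card e = 2" by (auto simp: pv pairs_def)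
    then have fin: "finite e" "e \<noteq> {}" by (auto intro: finite_subset)
    then have "1 \<le> Min e" using Min_in[of e] e(1) by force
    then show "C e \<subseteq> Q" using e assms by (auto simp: C_def Q_def)
    have "card (C e) = card e * m + card X"
      unfolding C_def using X fin by (subst card_Un_disjoint) auto
    then show "card (C e) = k" using e k by simp
  next
    fix e f assume "(e, f) \<in> parcs (kneser_graph d 2)"
    then show "C e \<inter> C f = {}"
      using min_colouring_disjoint[of e d f] assms X by (auto simp: C_def pa)
  qed (auto simp: pv pa)
  then show ?thesis by (simp add: cQ)
qed

theorem theorem1p6:
  fixes k d :: nat
  assumes "k \<ge> 1" and "d \<ge> 4"
  shows "int (xi k (kneser_graph d 2)) = \<lceil>real k / 2\<rceil> * (int d - 4) + 2 * int k"
proof -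
  have "xi k (kneser_graph d 2) = (k + 1) div 2 * (d - 4) + 2 * k"
    unfolding xi_def
  proof (rule Least_equality)
    show "\<exists>U. orthogonal_subspace_representation ((k + 1) div 2 * (d - 4) + 2 * k) k (kneser_graph d 2) U"
      using kneser_representation_exists[OF assms(2)] .
  next
    fix t assume "\<exists>U. orthogonal_subspace_representation t k (kneser_graph d 2) U"
    then obtain U where "orthogonal_subspace_representation t k (kneser_graph d 2) U" ..
    \<comment> \<open>The whole of \<open>real_space t\<close> serves as the initial ambient
      space.\<close>
    then interpret pair_representation t k "{1..d}" "real_space t" U
      by unfold_locales
        (auto simp: orthogonal_subspace_representation_def kneser_graph_def pairs_def subspace_real_space)
    show "(k + 1) div 2 * (d - 4) + 2 * k \<le> t"
      using dim_lower_bound assms by (simp add: dim_real_space)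
  qed
  moreover have "\<lceil>real k / 2\<rceil> = int ((k + 1) div 2)"
    by (rule ceiling_unique) (auto simp: field_simps; linarith)+
  ultimately show ?thesis using assms(2) by (simp add: of_nat_diff)
qed

end
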